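(* Fix an integer $d \geq 1$. Consider the multiobjective $0$--$1$ knapsack problem with $n$ objects, feasible set $\{0,1\}^n$, weight vector $w = (1, \dots, 1) \in \mathbb{R}^n$ (to be minimized), and $d$ profit vectors $v^{(1)}, \dots, v^{(d)} \in \mathbb{R}^n$ (to be maximized), where all profit entries $v^{(i)}_j$ are chosen independently and uniformly at random from $[0,1]$. Then the expected number of Pareto-optimal solutions is $\Omega_d(n^{d-1.5})$, where the constant in $\Omega_d$ may depend on $d$ but not on $n$.
   Context: In the knapsack problem, for $x, y \in \{0,1\}^n$, $y$ dominates $x$ if $w \cdot y \leq w \cdot x$ and $v^{(i)} \cdot y \geq v^{(i)} \cdot x$ for all $i \in [d]$, with at least one of these $d+1$ inequalities strict. A feasible solution $x$ is Pareto-optimal if no feasible $y$ dominates it. *)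

theory Defs
  imports "HOL-Probability.Probability"
begin

text \<open>A 0-1 vector x in {0,1}^n is encoded as its support S \<subseteq> {..<n}.
  Profits are given by v :: nat \<times> nat \<Rightarrow> real, with v (i,j) the j-th entry of
  the i-th profit vector (i < d, j < n). The weight vector is (1,...,1), so the
  weight of x is card S.\<close>

definition dominates :: "nat \<Rightarrow> (nat \<times> nat \<Rightarrow> real) \<Rightarrow> nat set \<Rightarrow> nat set \<Rightarrow> bool" where
  "dominates d v T S \<longleftrightarrow>
     card T \<le> card S \<and> (\<forall>i<d. (\<Sum>j\<in>T. v (i,j)) \<ge> (\<Sum>j\<in>S. v (i,j))) \<and>
     (card T < card S \<or> (\<exists>i<d. (\<Sum>j\<in>T. v (i,j)) > (\<Sum>j\<in>S. v (i,j))))"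

definition pareto_optimal :: "nat \<Rightarrow> nat \<Rightarrow> (nat \<times> nat \<Rightarrow> real) \<Rightarrow> nat set \<Rightarrow> bool" where
  "pareto_optimal d n v S \<longleftrightarrow> S \<subseteq> {..<n} \<and> \<not> (\<exists>T. T \<subseteq> {..<n} \<and> dominates d v T S)"

definition num_pareto :: "nat \<Rightarrow> nat \<Rightarrow> (nat \<times> nat \<Rightarrow> real) \<Rightarrow> nat" where
  "num_pareto d n v = card {S. pareto_optimal d n v S}"

definition profit_space :: "nat \<Rightarrow> nat \<Rightarrow> (nat \<times> nat \<Rightarrow> real) measure" where
  "profit_space d n = PiM ({..<d} \<times> {..<n}) (\<lambda>_. uniform_measure lborel {0..1})"

definition expected_num_pareto :: "nat \<Rightarrow> nat \<Rightarrow> real" where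
  "expected_num_pareto d n = (\<integral>v. real (num_pareto d n v) \<partial>profit_space d n)"

end

theory Submission
  imports Defs "HOL-Real_Asymp.Real_Asymp"
begin

text \<open>For positive weights \<open>a\<close>, the set of objects \<open>j\<close> with \<open>(\<Sum>k<d. a k * v (k,j)) > 1\<close> maximises a
  strictly monotone linear functional of the profits and the cardinality, so it is
  Pareto-optimal. Let \<open>a\<close> range over the \<open>m ^ d\<close> points of a grid of width \<open>1 / m\<close> in \<open>[1,2]^d\<close>.
  The wedge between the hyperplanes of two distinct grid points has probability at least
  \<open>\<kappa> / m\<close> under the distribution of a single column, so the two threshold sets agree with
  probability at most \<open>(1 - \<kappa> / m) ^ n\<close>. For \<open>m\<close> of order \<open>n powr (1 - 1 / d)\<close> a union bound shows
  that all \<open>m ^ d\<close> threshold sets are distinct with probability at least \<open>1/2\<close>; this already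
  gives an expected number of order \<open>n ^ (d - 1)\<close>.\<close>

section \<open>Threshold sets and their Pareto optimality\<close>

definition threshold_set :: "nat \<Rightarrow> nat \<Rightarrow> (nat \<Rightarrow> real) \<Rightarrow> (nat \<times> nat \<Rightarrow> real) \<Rightarrow> nat set" where
  "threshold_set d n a v = {j. j < n \<and> 1 < (\<Sum>k<d. a k * v (k,j))}"

lemma threshold_set_pareto_optimal:
  assumes a: "\<And>k. k < d \<Longrightarrow> 0 < a k"
  shows "pareto_optimal d n v (threshold_set d n a v)"
proof -
  define S where "S = threshold_set d n a v"
  \<comment> \<open>\<open>h j\<close> is the gain of object \<open>j\<close>: its weighted profit
    minus its unit weight. The threshold set keeps exactly the objects of positive gain, so it
    maximises \<open>sum h\<close>.\<close>
  define h where "h j = (\<Sum>k<d. a k * v (k,j)) - 1" for j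
  have S: "S \<subseteq> {..<n}" "finite S"
    by (auto simp: S_def threshold_set_def)
  have h_sum: "sum h T = (\<Sum>k<d. a k * (\<Sum>j\<in>T. v (k,j))) - real (card T)" for T
    unfolding h_def sum_subtractf sum_distrib_left by (subst sum.swap) simp
  have False if T: "T \<subseteq> {..<n}" and dom: "dominates d v T S" for T
  proof -
    have fT: "finite T" using T finite_subset by blast
    have "sum h T = sum h (T \<inter> S) + sum h (T - S)"
      using fT by (metis sum.Int_Diff)
    also have "\<dots> \<le> sum h (T \<inter> S) + 0"
      using T by (intro add_left_mono sum_nonpos) (auto simp: h_def S_def threshold_set_def)
    also have "\<dots> \<le> sum h (S \<inter> T) + sum h (S - T)"
      by (auto simp: Int_commute h_def S_def threshold_set_def intro!: sum_nonneg)
    also have "\<dots> = sum h S"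
      using S(2) by (metis sum.Int_Diff)
    finally have le: "sum h T \<le> sum h S" .
    have ge: "(\<Sum>k<d. a k * (\<Sum>j\<in>S. v (k,j))) \<le> (\<Sum>k<d. a k * (\<Sum>j\<in>T. v (k,j)))"
      using dom a by (intro sum_mono mult_left_mono) (auto simp: dominates_def less_imp_le)
    \<comment> \<open>All \<open>d + 1\<close> criteria enter \<open>sum h\<close> with a nonzero
      coefficient of the favourable sign (-1 for the weight), so one strict criterion already makes
      \<open>sum h T\<close> exceed \<open>sum h S\<close>.\<close>
    from dom consider "card T < card S"
      | i where "card T \<le> card S" "i < d" "(\<Sum>j\<in>S. v (i,j)) < (\<Sum>j\<in>T. v (i,j))"
      by (auto simp: dominates_def)
    then show False
    proof cases
      case 1
      with le ge show False by (simp add: h_sum)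
    next
      case 2
      have "(\<Sum>k<d. a k * (\<Sum>j\<in>S. v (k,j))) < (\<Sum>k<d. a k * (\<Sum>j\<in>T. v (k,j)))"
        using dom a 2
        by (intro sum_strict_mono_ex1) (auto simp: dominates_def less_imp_le intro!: mult_left_mono)
      with le 2 show False by (simp add: h_sum)
    qed
  qed
  then show ?thesis
    using S(1) by (auto simp: pareto_optimal_def S_def)
qed

section \<open>Products of the uniform distribution\<close>

abbreviation unif :: "real measure" where
  "unif \<equiv> uniform_measure lborel {0..1}"

lemma prob_space_unif: "prob_space unif"
  by (rule prob_space_uniform_measure) auto

text \<open>The index set stays arbitrary because products over all entries but one are needed as
  well.\<close>

interpretation unif: product_prob_space "\<lambda>_::'i. unif" I for I :: "'i set"
  by (intro product_prob_spaceI prob_space_unif)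

lemma emeasure_unif_interval:
  assumes "0 \<le> a" "a \<le> b" "b \<le> 1"
  shows "emeasure unif {a<..<b} = ennreal (b - a)" "emeasure unif {a..b} = ennreal (b - a)"
proof -
  have "{0..1} \<inter> {a<..<b} = {a<..<b}" "{0..1} \<inter> {a..b} = {a..b}" using assms by auto
  then show "emeasure unif {a<..<b} = ennreal (b - a)" "emeasure unif {a..b} = ennreal (b - a)"
    using assms divide_ennreal[of "b - a" 1] by (simp_all add: emeasure_uniform_measure)
qed

text \<open>The joint law of the coordinates is the product measure itself and each marginal is the
  corresponding factor, which characterises independence.\<close>

lemma indep_vars_PiM_components:
  assumes M: "\<And>i. i \<in> I \<Longrightarrow> prob_space (M i)" and I: "finite I" "I \<noteq> {}"
  shows "prob_space.indep_vars (PiM I M) M (\<lambda>i x. x i) I"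
proof -
  interpret prob_space "PiM I M" using M by (rule prob_space_PiM)
  have "distr (PiM I M) (PiM I M) (\<lambda>x. \<lambda>i\<in>I. x i) = distr (PiM I M) (PiM I M) (\<lambda>x. x)"
    by (intro distr_cong) (auto simp: space_PiM)
  also have "\<dots> = PiM I M" by (simp add: distr_id)
  also have "\<dots> = PiM I (\<lambda>i. distr (PiM I M) (M i) (\<lambda>x. x i))"
    using assms by (intro PiM_cong refl) (simp add: distr_PiM_component)
  finally show ?thesis
    by (subst indep_vars_iff_distr_eq_PiM'[OF I(2)]) simp_all
qed

lemma measurable_profit_component:
  assumes "i < d" "j < n"
  shows "(\<lambda>v. v (i,j)) \<in> borel_measurable (profit_space d n)"
proof -
  have "(\<lambda>v. v (i,j)) \<in> measurable (profit_space d n) unif"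
    unfolding profit_space_def using assms by (intro measurable_component_singleton) auto
  then show ?thesis by (simp add: measurable_def)
qed

lemma prob_space_profit_space: "prob_space (profit_space d n)"
  unfolding profit_space_def by (intro prob_space_PiM prob_space_unif)

lemma measurable_threshold_set [measurable]:
  assumes "j < n"
  shows "Measurable.pred (profit_space d n) (\<lambda>v. j \<in> threshold_set d n a v)"
  using assms measurable_profit_component[measurable] unfolding threshold_set_def by simp

section \<open>Separation of two weight vectors by one column\<close>

text \<open>Coordinate \<open>i\<close> is the one in which the weights differ most. If the other coordinates are
  small, they cannot compensate for that difference, which leaves a window for the \<open>i\<close>-th one.\<close>

lemma threshold_interval:
  fixes a b u :: "'k \<Rightarrow> real"
  assumes K: "finite K" "i \<in> K"
    and a: "\<And>k. k \<in> K \<Longrightarrow> a k \<in> {1..2}" and b: "\<And>k. k \<in> K \<Longrightarrow> b k \<in> {1..2}"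
    and ab: "\<And>k. k \<in> K \<Longrightarrow> \<bar>a k - b k\<bar> \<le> a i - b i"
    and u: "\<And>k. k \<in> K - {i} \<Longrightarrow> u k \<in> {0..1 / (8 * real (card K))}"
  obtains lo hi where "0 \<le> lo" "lo \<le> hi" "hi \<le> 1" "(a i - b i) / 8 \<le> hi - lo"
    "\<And>x. x \<in> {lo<..<hi} \<Longrightarrow> 1 < a i * x + (\<Sum>k\<in>K - {i}. a k * u k)"
    "\<And>x. x \<in> {lo<..<hi} \<Longrightarrow> b i * x + (\<Sum>k\<in>K - {i}. b k * u k) < 1"
proof -
  define D where "D = a i - b i"
  define s where "s = (\<Sum>k\<in>K - {i}. a k * u k)"
  define t where "t = (\<Sum>k\<in>K - {i}. b k * u k)"
  define r where "r = (\<Sum>k\<in>K - {i}. u k)"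
  have D: "0 \<le> D" using ab[OF K(2)] by (simp add: D_def)
  have ai: "1 \<le> a i" "a i \<le> 2" and bi: "1 \<le> b i" "b i \<le> 2" using a b K by auto
  have u0: "0 \<le> u k" if "k \<in> K - {i}" for k using u[OF that] by simp
  have card: "real (card K) > 0" using K by (auto simp: card_gt_0_iff)
  have r: "r \<le> 1 / 8"
  proof -
    have "r \<le> real (card (K - {i})) * (1 / (8 * real (card K)))"
      unfolding r_def using u by (intro sum_bounded_above) auto
    also have "\<dots> \<le> real (card K) * (1 / (8 * real (card K)))"
      using K by (intro mult_right_mono) (auto intro: card_mono)
    also have "\<dots> = 1 / 8" using card by simp
    finally show ?thesis .
  qed
  have "s \<le> (\<Sum>k\<in>K - {i}. 2 * u k)"
    unfolding s_def using a u0 by (intro sum_mono mult_right_mono) auto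
  then have s: "s \<le> 2 * r" by (simp add: r_def sum_distrib_left)
  have t: "0 \<le> t"
    unfolding t_def using b u0 by (intro sum_nonneg mult_nonneg_nonneg) force+
  \<comment> \<open>As no coordinate differs by more than \<open>D\<close>, changing the weights
    from \<open>a\<close> to \<open>b\<close> raises the contribution of the others by at most
    \<open>D * r\<close>.\<close>
  have "t - s = (\<Sum>k\<in>K - {i}. (b k - a k) * u k)"
    by (simp add: t_def s_def sum_subtractf left_diff_distrib)
  also have "\<dots> \<le> (\<Sum>k\<in>K - {i}. D * u k)"
    using ab u0 by (intro sum_mono mult_right_mono) (auto simp: D_def abs_le_iff)
  finally have ts: "t - s \<le> D * r" by (simp add: r_def sum_distrib_left)
  \<comment> \<open>With the other coordinates fixed, \<open>lo\<close> and \<open>hi\<close> are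
    the points where the i-th coordinate meets the hyperplanes of \<open>a\<close> and of
    \<open>b\<close>.\<close>
  define lo where "lo = (1 - s) / a i"
  define hi where "hi = (1 - t) / b i"
  have lo: "a i * lo = 1 - s" and hi: "b i * hi = 1 - t"
    using ai bi by (auto simp: lo_def hi_def)
  \<comment> \<open>Here s \<le> 2 r \<le> 1/4 and \<open>a i\<close> is at most 2, so the quotient
    is at least (3/4) / 2.\<close>
  have lo_ge: "3 / 8 \<le> lo"
    unfolding lo_def using ai s r by (simp add: field_simps)
  have hi_le: "hi \<le> 1"
    unfolding hi_def using bi t by (simp add: field_simps)
  have "b i * (hi - lo) = D * lo + s - t"
    using lo hi by (simp add: D_def algebra_simps)
  also have "\<dots> \<ge> D * (lo - r)"
    using ts by (simp add: algebra_simps)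
  finally have 1: "D * (lo - r) \<le> b i * (hi - lo)" .
  \<comment> \<open>The constant is 3/8 - 1/8; dividing by b i \<le> 2 below turns 1/4 into
    1/8.\<close>
  have "D * (1 / 4) \<le> D * (lo - r)"
    using D lo_ge r by (intro mult_left_mono) auto
  with 1 have 2: "D / 4 \<le> b i * (hi - lo)" by simp
  have nn: "0 \<le> hi - lo"
    using 2 D bi by (smt (verit) divide_nonneg_nonneg zero_le_mult_iff)
  then have "b i * (hi - lo) \<le> 2 * (hi - lo)"
    using bi by (intro mult_right_mono) auto
  with 2 have 3: "D / 8 \<le> hi - lo" by simp
  show ?thesis
  proof (rule that)
    show "0 \<le> lo" "lo \<le> hi" "hi \<le> 1" using lo_ge nn hi_le by auto
    show "(a i - b i) / 8 \<le> hi - lo" using 3 by (simp add: D_def)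
    fix x assume x: "x \<in> {lo<..<hi}"
    have "a i * lo < a i * x" "b i * x < b i * hi"
      using x ai bi by auto
    then show "1 < a i * x + (\<Sum>k\<in>K - {i}. a k * u k)"
      "b i * x + (\<Sum>k\<in>K - {i}. b k * u k) < 1"
      unfolding lo hi by (simp_all flip: s_def t_def)
  qed
qed

text \<open>Fubini, with the entry \<open>(i,j)\<close> integrated innermost: the other
  \<open>d - 1\<close> entries of column \<open>j\<close> all lie in \<open>[0, 1 / (8 * d)]\<close>
  with probability equal to the first factor, and then \<open>threshold_interval\<close> leaves a
  window for the entry \<open>(i,j)\<close> whose length is at least the second.\<close>

lemma prob_threshold_separates:
  assumes i: "i < d" and j: "j < n"
    and a: "\<And>k. k < d \<Longrightarrow> a k \<in> {1..2}" and b: "\<And>k. k < d \<Longrightarrow> b k \<in> {1..2}"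
    and ab: "\<And>k. k < d \<Longrightarrow> \<bar>a k - b k\<bar> \<le> a i - b i"
  shows "(1 / (8 * real d)) ^ (d - 1) * ((a i - b i) / 8)
    \<le> measure (profit_space d n)
        {v \<in> space (profit_space d n). j \<in> threshold_set d n a v \<and> j \<notin> threshold_set d n b v}"
    (is "_ \<le> measure ?M ?A")
proof -
  interpret prob_space ?M by (rule prob_space_profit_space)
  define e where "e = 1 / (8 * real d)"
  define c where "c = (a i - b i) / 8"
  define J where "J = {..<d} \<times> {..<n} - {(i,j)}"
  define C where "C = ({..<d} - {i}) \<times> {j}"
  define B where "B = {y \<in> space (PiM J (\<lambda>_. unif)). \<forall>p\<in>C. y p \<in> {0..e}}"
  have I: "insert (i,j) J = {..<d} \<times> {..<n}" using i j by (auto simp: J_def)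
  have J: "finite J" "(i,j) \<notin> J" by (auto simp: J_def)
  have C: "C \<subseteq> J" "finite C" using j by (auto simp: C_def J_def)
  have c: "0 \<le> c" using ab[OF i] by (simp add: c_def)
  have e: "0 \<le> e" "e \<le> 1" using i by (auto simp: e_def)
  have B: "B \<in> sets (PiM J (\<lambda>_. unif))"
  proof -
    have "{y \<in> space (PiM J (\<lambda>_. unif)). y p \<in> {0..e}} \<in> sets (PiM J (\<lambda>_. unif))" if "p \<in> C" for p
      using that C by (intro sets_Collect_single') auto
    then show ?thesis
      unfolding B_def using C by (intro sets.sets_Collect_finite_All) auto
  qed
  have "emeasure (PiM J (\<lambda>_. unif)) B = (\<Prod>p\<in>C. emeasure unif {0..e})"
    unfolding B_def using C by (intro unif.emeasure_PiM_Collect) auto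
  also have "\<dots> = ennreal e ^ card C"
    using e emeasure_unif_interval(2)[of 0 e] by simp
  also have "card C = d - 1"
    using i by (simp add: C_def)
  finally have emB: "emeasure (PiM J (\<lambda>_. unif)) B = ennreal (e ^ (d - 1))"
    using e by (simp add: ennreal_power)
  have A: "?A \<in> sets ?M" using j by measurable
  \<comment> \<open>Off \<open>B\<close> the left side vanishes; on \<open>B\<close> the section of
    the event contains the window \<open>{lo<..<hi}\<close>.\<close>
  have inner: "ennreal c * indicator B y \<le> (\<integral>\<^sup>+ x. indicator ?A (y((i,j) := x)) \<partial>unif)"
    if y: "y \<in> space (PiM J (\<lambda>_. unif))" for y
  proof (cases "y \<in> B")
    case True
    then have u: "y (k,j) \<in> {0..1 / (8 * real (card {..<d}))}" if "k \<in> {..<d} - {i}" for k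
      using that by (auto simp: B_def C_def e_def)
    have sp: "y((i,j) := x) \<in> space ?M" for x
      using y unfolding profit_space_def I[symmetric] space_PiM by (auto simp: PiE_def extensional_def)
    obtain lo hi where lh: "0 \<le> lo" "lo \<le> hi" "hi \<le> 1" "c \<le> hi - lo"
      "\<And>x. x \<in> {lo<..<hi} \<Longrightarrow> 1 < a i * x + (\<Sum>k\<in>{..<d} - {i}. a k * y (k,j))"
      "\<And>x. x \<in> {lo<..<hi} \<Longrightarrow> b i * x + (\<Sum>k\<in>{..<d} - {i}. b k * y (k,j)) < 1"
      by (rule threshold_interval[of "{..<d}" i a b "\<lambda>k. y (k,j)"]) (use i a b ab u in \<open>auto simp: c_def\<close>)
    have sum_upd: "(\<Sum>k<d. l k * (y((i,j) := x)) (k,j)) = l i * x + (\<Sum>k\<in>{..<d} - {i}. l k * y (k,j))"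
      for l x
      using i by (subst sum.remove[of _ i]) (auto intro!: sum.cong)
    have "ennreal c * indicator B y \<le> ennreal (hi - lo)"
      using True lh by (simp add: ennreal_leI)
    also have "\<dots> = (\<integral>\<^sup>+ x. indicator {lo<..<hi} x \<partial>unif)"
      using lh(1-3) emeasure_unif_interval(1)[of lo hi] by simp
    also have "\<dots> \<le> (\<integral>\<^sup>+ x. indicator ?A (y((i,j) := x)) \<partial>unif)"
    proof (intro nn_integral_mono)
      fix x :: real
      have "y((i,j) := x) \<in> ?A" if "x \<in> {lo<..<hi}"
        using lh(5,6)[OF that] sp j by (simp add: threshold_set_def sum_upd del: fun_upd_apply)
      then show "indicator {lo<..<hi} x \<le> (indicator ?A (y((i,j) := x)) :: ennreal)"
        by (auto simp: indicator_def)
    qed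
    finally show ?thesis .
  qed simp
  have "ennreal (c * e ^ (d - 1)) = (\<integral>\<^sup>+ y. ennreal c * indicator B y \<partial>PiM J (\<lambda>_. unif))"
    using B c e by (simp add: nn_integral_cmult emB ennreal_mult)
  also have "\<dots> \<le> (\<integral>\<^sup>+ y. \<integral>\<^sup>+ x. indicator ?A (y((i,j) := x)) \<partial>unif \<partial>PiM J (\<lambda>_. unif))"
    by (intro nn_integral_mono inner)
  also have "\<dots> = (\<integral>\<^sup>+ v. indicator ?A v \<partial>PiM (insert (i,j) J) (\<lambda>_. unif))"
    using J A by (intro unif.product_nn_integral_insert[symmetric]) (auto simp: I profit_space_def)
  also have "\<dots> = emeasure ?M ?A"
    using A by (simp add: I profit_space_def)
  finally have "ennreal (c * e ^ (d - 1)) \<le> ennreal (measure ?M ?A)"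
    by (simp add: emeasure_eq_measure)
  then show ?thesis
    by (simp add: c_def e_def mult.commute)
qed

section \<open>Amplification over independent columns\<close>

text \<open>The columns of the profit matrix are independent, so the separation probability of a
  single column is amplified over all \<open>n\<close> of them.\<close>

lemma prob_threshold_set_eq:
  assumes i: "i < d" and n: "0 < n"
    and a: "\<And>k. k < d \<Longrightarrow> a k \<in> {1..2}" and b: "\<And>k. k < d \<Longrightarrow> b k \<in> {1..2}"
    and ab: "\<And>k. k < d \<Longrightarrow> \<bar>a k - b k\<bar> \<le> a i - b i"
  shows "measure (profit_space d n)
      {v \<in> space (profit_space d n). threshold_set d n a v = threshold_set d n b v}
    \<le> (1 - (1 / (8 * real d)) ^ (d - 1) * ((a i - b i) / 8)) ^ n"
    (is "measure ?M ?E \<le> (1 - ?p) ^ n")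
proof -
  interpret prob_space ?M by (rule prob_space_profit_space)
  define K where "K j = {..<d} \<times> {j}" for j :: nat
  \<comment> \<open>Unlike membership in \<open>threshold_set\<close>, \<open>sep j\<close> refers
    to column \<open>j\<close> alone, so its negation defines an event \<open>A j\<close> on the
    product over \<open>K j\<close>.\<close>
  define sep where "sep j v \<longleftrightarrow> 1 < (\<Sum>k<d. a k * v (k,j)) \<and> \<not> 1 < (\<Sum>k<d. b k * v (k,j))"
    for j :: nat and v
  define A where "A j = {y \<in> space (PiM (K j) (\<lambda>_. unif)). \<not> sep j y}" for j
  define X where "X j v = restrict v (K j)" for j and v :: "nat \<times> nat \<Rightarrow> real"
  have "indep_vars (\<lambda>_. unif) (\<lambda>i v. v i) ({..<d} \<times> {..<n})"
    unfolding profit_space_def using i n by (intro indep_vars_PiM_components prob_space_unif) auto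
  then have ind: "indep_vars (\<lambda>j. PiM (K j) (\<lambda>_. unif)) X {..<n}"
    unfolding X_def by (rule indep_vars_restrict) (auto simp: K_def disjoint_family_on_def)
  have comp: "(\<lambda>y. y (k,j)) \<in> borel_measurable (PiM (K j) (\<lambda>_. unif))" if "k < d" for k j
  proof -
    have "(\<lambda>y. y (k,j)) \<in> measurable (PiM (K j) (\<lambda>_. unif)) unif"
      using that by (intro measurable_component_singleton) (auto simp: K_def)
    then show ?thesis by (simp add: measurable_def)
  qed
  have A: "A j \<in> sets (PiM (K j) (\<lambda>_. unif))" for j
    unfolding A_def sep_def using comp[measurable] by measurable
  have sep_restrict: "sep j (restrict v (K j)) = sep j v" for j v
    by (simp add: sep_def K_def)
  have vim: "X j -` A j \<inter> space ?M = {v \<in> space ?M. \<not> sep j v}" if "j < n" for j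
    using that by (auto simp: A_def X_def sep_restrict space_PiM)
  have pj: "prob (X j -` A j \<inter> space ?M) \<le> 1 - ?p" if j: "j < n" for j
  proof -
    have eq: "{v \<in> space ?M. sep j v}
        = {v \<in> space ?M. j \<in> threshold_set d n a v \<and> j \<notin> threshold_set d n b v}"
      using j by (auto simp: sep_def threshold_set_def)
    have "?p \<le> prob {v \<in> space ?M. sep j v}"
      unfolding eq using assms j by (intro prob_threshold_separates) auto
    moreover have "{v \<in> space ?M. sep j v} \<in> events"
      unfolding eq using j by measurable
    ultimately show ?thesis
      unfolding vim[OF j] by (simp add: prob_neg)
  qed
  \<comment> \<open>If the threshold sets agree, no column separates them. Only separation in the
    direction from \<open>a\<close> to \<open>b\<close> is counted, so this is an inclusion.\<close>
  have "?E \<subseteq> (\<Inter>j\<in>{..<n}. X j -` A j \<inter> space ?M)"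
  proof (intro INT_greatest subsetI)
    fix j v assume j: "j \<in> {..<n}" and "v \<in> ?E"
    then show "v \<in> X j -` A j \<inter> space ?M"
      by (auto simp: vim sep_def threshold_set_def set_eq_iff)
  qed
  moreover have "(\<Inter>j\<in>{..<n}. X j -` A j \<inter> space ?M) \<in> events"
    using n ind A by (intro sets.finite_INT) (auto simp: indep_vars_def intro: measurable_sets)
  ultimately have "prob ?E \<le> prob (\<Inter>j\<in>{..<n}. X j -` A j \<inter> space ?M)"
    by (rule finite_measure_mono)
  also have "\<dots> = (\<Prod>j<n. prob (X j -` A j \<inter> space ?M))"
    using n A by (intro indep_varsD_finite[OF ind]) auto
  also have "\<dots> \<le> (\<Prod>j<n. 1 - ?p)"
    using pj by (intro prod_mono) auto
  finally show ?thesis by simp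
qed

section \<open>The weight grid and its collision probabilities\<close>

definition grid_weight :: "nat \<Rightarrow> (nat \<Rightarrow> nat) \<Rightarrow> nat \<Rightarrow> real" where
  "grid_weight m f k = 1 + real (f k) / real m"

text \<open>Extensionality makes distinct elements differ at some coordinate below \<open>d\<close>,
  and gives the count \<open>m ^ d\<close>.\<close>

definition grid :: "nat \<Rightarrow> nat \<Rightarrow> (nat \<Rightarrow> nat) set" where
  "grid d m = {..<d} \<rightarrow>\<^sub>E {..<m}"

lemma finite_grid [simp]: "finite (grid d m)" and card_grid: "card (grid d m) = m ^ d"
  by (auto simp: grid_def card_PiE intro: finite_PiE)

lemma grid_weight_bounds:
  "f \<in> grid d m \<Longrightarrow> k < d \<Longrightarrow> grid_weight m f k \<in> {1..2}"
  by (auto simp: grid_def grid_weight_def PiE_def Pi_def less_imp_le divide_le_eq_1)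

lemma prob_grid_collision_ordered:
  assumes fg: "f \<in> grid d m" "g \<in> grid d m" and i: "i < d" "g i < f i" and n: "0 < n"
    and le: "\<And>k. k < d \<Longrightarrow> \<bar>real (f k) - real (g k)\<bar> \<le> real (f i) - real (g i)"
  shows "measure (profit_space d n) {v \<in> space (profit_space d n).
      threshold_set d n (grid_weight m f) v = threshold_set d n (grid_weight m g) v}
    \<le> exp (- ((1 / (8 * real d)) ^ d * real n / real m))"
    (is "?P \<le> _")
proof -
  define a where "a = grid_weight m f"
  define b where "b = grid_weight m g"
  define e where "e = 1 / (8 * real d)"
  define p where "p = e ^ (d - 1) * ((a i - b i) / 8)"
  have m: "0 < m" using fg(1) i by (auto simp: grid_def PiE_def Pi_def)
  have diff: "a k - b k = (real (f k) - real (g k)) / real m" for k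
    by (simp add: a_def b_def grid_weight_def diff_divide_distrib)
  have bounds: "a k \<in> {1..2}" "b k \<in> {1..2}" if "k < d" for k
    unfolding a_def b_def using that fg grid_weight_bounds by blast+
  have ab: "\<bar>a k - b k\<bar> \<le> a i - b i" if "k < d" for k
    unfolding diff using le[OF that] m by (simp add: abs_divide divide_right_mono)
  have e: "0 \<le> e" "e \<le> 1" using i by (auto simp: e_def)
  have ai: "1 / real m \<le> a i - b i"
    unfolding diff using i by (intro divide_right_mono) auto
  \<comment> \<open>This makes \<open>1 - p\<close> nonnegative, so that 1 - p \<le> exp (- p) can
    be raised to the power \<open>n\<close>.\<close>
  have "p \<le> 1 * (1 / 8)"
    unfolding p_def using e bounds[OF i(1)] ab[OF i(1)]
    by (intro mult_mono power_le_one) auto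
  then have p1: "p \<le> 1" by simp
  \<comment> \<open>One more factor e \<le> 1/8 absorbs the constant 1/8, and the weights differ by
    at least \<open>1 / m\<close> in coordinate \<open>i\<close>.\<close>
  have "e ^ d / real m = e ^ (d - 1) * (e * (1 / real m))"
    using i by (simp add: power_eq_if)
  also have "\<dots> \<le> e ^ (d - 1) * (1 / 8 * (a i - b i))"
    using e ai i by (intro mult_left_mono mult_mono) (auto simp: e_def)
  finally have p_ge: "e ^ d / real m \<le> p" by (simp add: p_def)
  have "?P \<le> (1 - p) ^ n"
    unfolding p_def e_def a_def[symmetric] b_def[symmetric]
    using i n bounds ab by (intro prob_threshold_set_eq) auto
  also have "\<dots> \<le> exp (- p) ^ n"
    using p1 exp_ge_add_one_self[of "- p"] by (intro power_mono) auto
  also have "\<dots> = exp (- (p * real n))"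
    by (simp add: exp_of_nat_mult[symmetric] mult.commute)
  also have "\<dots> \<le> exp (- (e ^ d / real m * real n))"
    using mult_right_mono[OF p_ge, of "real n"] by simp
  finally show ?thesis by (simp add: e_def)
qed

text \<open>A coordinate of largest absolute difference serves as \<open>i\<close>; the sign of the
  difference there decides which of \<open>f\<close> and \<open>g\<close> takes the first role,
  since the collision event is symmetric.\<close>

lemma prob_grid_collision:
  assumes fg: "f \<in> grid d m" "g \<in> grid d m" "f \<noteq> g" and n: "0 < n"
  shows "measure (profit_space d n) {v \<in> space (profit_space d n).
      threshold_set d n (grid_weight m f) v = threshold_set d n (grid_weight m g) v}
    \<le> exp (- ((1 / (8 * real d)) ^ d * real n / real m))"
proof -
  define Q where "Q k = \<bar>real (f k) - real (g k)\<bar>" for k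
  obtain k where k: "k < d" "f k \<noteq> g k"
    using fg by (auto simp: grid_def dest: PiE_ext)
  have "Max (Q ` {..<d}) \<in> Q ` {..<d}"
    using k by (intro Max_in) auto
  then obtain i where i: "i < d" "Q i = Max (Q ` {..<d})" by auto
  have le: "Q l \<le> Q i" if "l < d" for l
    unfolding i(2) using that by (intro Max_ge) auto
  have "f i \<noteq> g i"
    using le[OF k(1)] k by (auto simp: Q_def)
  then consider "g i < f i" | "f i < g i" by linarith
  then show ?thesis
  proof cases
    case 1
    with le show ?thesis
      by (intro prob_grid_collision_ordered[OF fg(1,2) i(1) _ n]) (auto simp: Q_def)
  next
    case 2
    have "measure (profit_space d n) {v \<in> space (profit_space d n).
        threshold_set d n (grid_weight m g) v = threshold_set d n (grid_weight m f) v}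
      \<le> exp (- ((1 / (8 * real d)) ^ d * real n / real m))"
      using 2 le
      by (intro prob_grid_collision_ordered[OF fg(2,1) i(1) _ n]) (auto simp: Q_def abs_minus_commute)
    then show ?thesis by (simp add: eq_commute)
  qed
qed

section \<open>From collisions to the expected number\<close>

lemma measurable_num_pareto [measurable]:
  "(\<lambda>v. real (num_pareto d n v)) \<in> borel_measurable (profit_space d n)"
proof -
  let ?D = "\<lambda>S v. \<exists>T\<in>Pow {..<n}. dominates d v T S"
  have sum: "(\<lambda>v. \<Sum>j\<in>T. v (i,j)) \<in> borel_measurable (profit_space d n)"
    if "i < d" "T \<in> Pow {..<n}" for i T
    using that by (intro borel_measurable_sum measurable_profit_component) auto
  have "Measurable.pred (profit_space d n) (\<lambda>v. dominates d v T S)"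
    if "T \<in> Pow {..<n}" "S \<in> Pow {..<n}" for T S
  proof -
    have [measurable]:
      "Measurable.pred (profit_space d n) (\<lambda>v. (\<Sum>j\<in>S. v (i,j)) \<le> (\<Sum>j\<in>T. v (i,j)))"
      "Measurable.pred (profit_space d n) (\<lambda>v. (\<Sum>j\<in>S. v (i,j)) < (\<Sum>j\<in>T. v (i,j)))"
      if "i \<in> {..<d}" for i
      using that \<open>T \<in> _\<close> \<open>S \<in> _\<close> sum
      by (auto intro!: borel_measurable_pred_less borel_measurable_le simp: pred_def)
    have "dominates d v T S \<longleftrightarrow>
        card T \<le> card S \<and> (\<forall>i\<in>{..<d}. (\<Sum>j\<in>S. v (i,j)) \<le> (\<Sum>j\<in>T. v (i,j))) \<and>
        (card T < card S \<or> (\<exists>i\<in>{..<d}. (\<Sum>j\<in>S. v (i,j)) < (\<Sum>j\<in>T. v (i,j))))" for v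
      by (auto simp: dominates_def)
    then show ?thesis by simp
  qed
  then have D: "Measurable.pred (profit_space d n) (?D S)" if "S \<in> Pow {..<n}" for S
    using that by (intro pred_intros_finite) auto
  have "real (num_pareto d n v) = (\<Sum>S\<in>Pow {..<n}. if ?D S v then 0 else 1)" for v
  proof -
    have "{S. pareto_optimal d n v S} = Pow {..<n} \<inter> - {S. ?D S v}"
      by (auto simp: pareto_optimal_def)
    then show ?thesis
      by (simp add: num_pareto_def sum.If_cases)
  qed
  moreover have "(\<lambda>v. \<Sum>S\<in>Pow {..<n}. if ?D S v then 0 else 1 :: real)
      \<in> borel_measurable (profit_space d n)"
    using D by (intro borel_measurable_sum measurable_If) auto
  ultimately show ?thesis by simp
qed

lemma finite_pareto_optimal: "finite {S. pareto_optimal d n v S}"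
  by (rule finite_subset[of _ "Pow {..<n}"]) (auto simp: pareto_optimal_def)

text \<open>The count is bounded by the number of subsets. Monotonicity of the Bochner integral in
  \<open>expected_num_pareto_ge\<close> relies on this.\<close>

lemma integrable_num_pareto: "integrable (profit_space d n) (\<lambda>v. real (num_pareto d n v))"
proof -
  interpret prob_space "profit_space d n" by (rule prob_space_profit_space)
  have "num_pareto d n v \<le> card (Pow {..<n})" for v
    unfolding num_pareto_def by (rule card_mono) (auto simp: pareto_optimal_def)
  then show ?thesis
    by (intro integrable_const_bound[where B = "real (card (Pow {..<n}))"]) auto
qed

text \<open>A union bound over at most \<open>m ^ (2 * d)\<close> ordered pairs of distinct grid
  points bounds the probability of any collision. Without a collision the grid yields
  \<open>m ^ d\<close> distinct Pareto-optimal sets.\<close>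

lemma expected_num_pareto_ge:
  assumes n: "0 < n"
  shows "real m ^ d * (1 - real m ^ (2 * d) * exp (- ((1 / (8 * real d)) ^ d * real n / real m)))
    \<le> expected_num_pareto d n"
    (is "_ * (1 - _ * ?\<epsilon>) \<le> _")
proof -
  let ?M = "profit_space d n"
  interpret prob_space ?M by (rule prob_space_profit_space)
  define T where "T f = threshold_set d n (grid_weight m f)" for f
  define P where "P = grid d m \<times> grid d m - Id"
  define E where "E = (\<lambda>(f,g). {v \<in> space ?M. T f v = T g v})"
  define Good where "Good = space ?M - (\<Union>p\<in>P. E p)"
  have P: "finite P" by (simp add: P_def)
  have E: "E p \<in> events" for p
  proof -
    \<comment> \<open>Threshold sets lie in \<open>{..<n}\<close>, so equality is a finite
      conjunction of measurable conditions.\<close>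
    have "E p = {v \<in> space ?M. \<forall>j\<in>{..<n}. j \<in> T (fst p) v \<longleftrightarrow> j \<in> T (snd p) v}"
      by (auto simp: E_def T_def threshold_set_def split: prod.splits)
    also have "\<dots> \<in> events"
      unfolding T_def by measurable
    finally show ?thesis .
  qed
  have Good: "Good \<in> events"
    unfolding Good_def using E P by (intro sets.Diff sets.top sets.finite_UN) auto
  have "prob (\<Union>p\<in>P. E p) \<le> (\<Sum>p\<in>P. prob (E p))"
    using P E by (intro finite_measure_subadditive_finite) auto
  also have "\<dots> \<le> (\<Sum>p\<in>P. ?\<epsilon>)"
    using n by (intro sum_mono) (auto simp: E_def P_def T_def intro!: prob_grid_collision)
  also have "\<dots> \<le> real m ^ (2 * d) * ?\<epsilon>"
  proof -
    have "card P \<le> card (grid d m \<times> grid d m)"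
      unfolding P_def by (intro card_mono) auto
    also have "\<dots> = m ^ (2 * d)"
      by (simp add: card_cartesian_product card_grid mult_2 power_add)
    finally have "real (card P) \<le> real m ^ (2 * d)"
      by (metis of_nat_le_iff of_nat_power)
    then show ?thesis by (simp add: mult_right_mono)
  qed
  finally have "1 - real m ^ (2 * d) * ?\<epsilon> \<le> prob Good"
    unfolding Good_def using E P by (subst prob_compl) auto
  then have "real m ^ d * (1 - real m ^ (2 * d) * ?\<epsilon>) \<le> real m ^ d * prob Good"
    by (intro mult_left_mono) auto
  also have "\<dots> = (\<integral>v. real m ^ d * indicator Good v \<partial>?M)"
    using Good by simp
  also have "\<dots> \<le> (\<integral>v. real (num_pareto d n v) \<partial>?M)"
  proof (intro integral_mono integrable_num_pareto)
    show "integrable ?M (\<lambda>v. real m ^ d * indicator Good v)"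
      using Good by (simp add: integrable_mult_right_iff less_top[symmetric])
    fix v assume v: "v \<in> space ?M"
    show "real m ^ d * indicator Good v \<le> real (num_pareto d n v)"
    proof (cases "v \<in> Good")
      case True
      then have inj: "inj_on (\<lambda>f. T f v) (grid d m)"
        by (auto simp: Good_def E_def P_def inj_on_def)
      have "(\<lambda>f. T f v) ` grid d m \<subseteq> {S. pareto_optimal d n v S}"
        unfolding T_def using grid_weight_bounds[of _ d m]
        by (auto intro!: threshold_set_pareto_optimal intro: less_le_trans[OF zero_less_one])
      then have "card ((\<lambda>f. T f v) ` grid d m) \<le> num_pareto d n v"
        unfolding num_pareto_def by (intro card_mono finite_pareto_optimal)
      then have "m ^ d \<le> num_pareto d n v"
        by (simp add: card_image[OF inj] card_grid)
      then have "real (m ^ d) \<le> real (num_pareto d n v)"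
        by (rule of_nat_mono)
      with True show ?thesis by simp
    qed simp
  qed
  finally show ?thesis by (simp add: expected_num_pareto_def)
qed

section \<open>Choice of the grid size and asymptotics\<close>

theorem theorem3:
  fixes d :: nat
  assumes "d \<ge> 1"
  shows "\<exists>c>0. \<exists>N. \<forall>n\<ge>N. expected_num_pareto d n \<ge> c * real n powr (real d - 3/2)"
proof -
  define \<kappa> :: real where "\<kappa> = (1 / (8 * real d)) ^ d"
  have \<kappa>: "0 < \<kappa>" and d: "0 < real d" using assms by (auto simp: \<kappa>_def)
  \<comment> \<open>This sequence will dominate the collision bound: m \<le> n and n / m \<ge> n
    powr (1 / d).\<close>
  have "(\<lambda>n::nat. real n ^ (2 * d) * exp (- (\<kappa> * real n powr (1 / real d)))) \<longlonglongrightarrow> 0"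
    using \<kappa> d by real_asymp
  then have "eventually (\<lambda>n. real n ^ (2 * d) * exp (- (\<kappa> * real n powr (1 / real d))) < 1 / 2) sequentially"
    by (rule order_tendstoD) simp
  then obtain N where N: "\<And>n. N \<le> n \<Longrightarrow>
      real n ^ (2 * d) * exp (- (\<kappa> * real n powr (1 / real d))) < 1 / 2"
    by (auto simp: eventually_sequentially)
  \<comment> \<open>A factor \<open>1 / 2 ^ d\<close> pays for rounding \<open>x\<close> down to
    \<open>m\<close>, the remaining 1/2 for the probability of a collision.\<close>
  define c :: real where "c = 1 / 2 ^ Suc d"
  have "c * real n powr (real d - 3/2) \<le> expected_num_pareto d n" if "max 1 N \<le> n" for n
  proof -
    have n: "1 \<le> n" "N \<le> n" using that by auto
    \<comment> \<open>This size gives x ^ d = n powr (d - 1), while \<open>n / x\<close> is still a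
      positive power of \<open>n\<close>, enough for the exponential to beat the number of
      pairs.\<close>
    define x where "x = real n powr (1 - 1 / real d)"
    define m where "m = nat \<lfloor>x\<rfloor>"
    have x: "1 \<le> x" "x \<le> real n"
      using n assms powr_mono[of "1 - 1 / real d" 1 "real n"] by (auto simp: x_def ge_one_powr_ge_zero)
    have m: "x / 2 \<le> real m" "real m \<le> x" "0 < m"
    proof -
      have "real m = of_int \<lfloor>x\<rfloor>" "1 \<le> real_of_int \<lfloor>x\<rfloor>"
        using x by (simp_all add: m_def)
      \<comment> \<open>As the floor is at least 1, x < floor + 1 \<le> 2 * floor.\<close>
      then show "x / 2 \<le> real m" using floor_correct[of x] by linarith
      show "real m \<le> x" using x by (simp add: m_def)
      show "0 < m" using x by (simp add: m_def)
    qed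
    have nx: "real n / x = real n powr (1 / real d)"
      using n by (simp add: x_def powr_diff)
    have "real m ^ (2 * d) * exp (- (\<kappa> * real n / real m))
        \<le> real n ^ (2 * d) * exp (- (\<kappa> * real n powr (1 / real d)))"
    proof (intro mult_mono power_mono)
      have "real n / x \<le> real n / real m"
        using m x by (intro divide_left_mono) auto
      then show "exp (- (\<kappa> * real n / real m)) \<le> exp (- (\<kappa> * real n powr (1 / real d)))"
        unfolding nx using \<kappa> by (simp add: mult_left_mono flip: times_divide_eq_right)
    qed (use m x in auto)
    also have "\<dots> \<le> 1 / 2" using N[OF n(2)] by simp
    finally have half: "1 / 2 \<le> 1 - real m ^ (2 * d) * exp (- (\<kappa> * real n / real m))"
      by simp
    have "x ^ d = real n powr (real d - 1)"
      using n d by (simp add: x_def powr_power right_diff_distrib)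
    \<comment> \<open>The bound is of order n powr (d - 1); half a power of \<open>n\<close> is
      given away here.\<close>
    then have "c * real n powr (real d - 3/2) \<le> c * x ^ d"
      using n by (auto simp: c_def intro!: powr_mono divide_right_mono)
    also have "\<dots> = (x / 2) ^ d * (1 / 2)"
      by (simp add: c_def power_divide)
    also have "\<dots> \<le> real m ^ d * (1 - real m ^ (2 * d) * exp (- (\<kappa> * real n / real m)))"
      using m x half by (intro mult_mono power_mono) auto
    also have "\<dots> \<le> expected_num_pareto d n"
      unfolding \<kappa>_def using n by (intro expected_num_pareto_ge) simp
    finally show ?thesis .
  qed
  moreover have "c > 0" by (simp add: c_def)
  ultimately show ?thesis by blast
qed

end
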